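(* Let $(L,\delta)$ be a lattice diversity where $L$ is a finite distributive lattice, and let $J(L)$ be the set of join-irreducible elements of $L$. For $A\subseteq J(L)$, define $$\hat{\delta}(A)=\begin{cases} \delta\left(\bigvee A\right), & \text{if } |A|\geq 2,\\ 0, & \text{otherwise.}\end{cases}$$ Then $(J(L),\hat{\delta})$ is a classical diversity whose restriction to $\mathcal{O}(J(L))$, the lattice of lower sets of $J(L)$, is isomorphic to $(L,\delta)$.
   Context: In a lattice $L$ with least element $0$, the atoms are the elements $a$ that cover $0$, i.e. $a>0$ and there is no $c\in L$ with $0<c<a$; $A(L)$ is the set of atoms. Lattice diversity: let $L$ be a lattice with least element $0$ and let $\delta\colon L\to\mathbb{R}_{\ge 0}$. The pair $(L,\delta)$ is a lattice diversity if for all $a,b\in L$: (1) $\delta(a)=0$ if and only if $a\in A(L)$ or $a=0$; (2) $a\le b$ implies $\delta(a)\le\delta(b)$; (3) $a\wedge b\ne 0$ implies $\delta(a\vee b)\le\delta(a)+\delta(b)$. Classical diversity: a set $X$ with a function $\delta$ from the finite subsets of $X$ to $\mathbb{R}_{\ge 0}$ such that (i) $\delta(A)=0$ if and only if $|A|\le 1$, and (ii) $\delta(A\cup C)\le\delta(A\cup B)+\delta(B\cup C)$ for all finite $A,B,C\subseteq X$ with $B\ne\emptyset$. An element $a\in L$ is join irreducible if $a\ne 0$ and $a=b\vee c$ implies $a=b$ or $a=c$; $J(L)$ is the set of these, with the order induced from $L$. $\bigvee A$ is the join of the elements of $A$ (with $\bigvee\emptyset=0$). For a poset $P$, $\mathcal{O}(P)$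 is the set of lower sets of $P$ (subsets $X\subseteq P$ such that $x\in X$, $y\le x$ imply $y\in X$), a distributive lattice under $\cup,\cap$ with least element $\emptyset$. By Birkhoff's representation theorem, $\eta\colon L\to\mathcal{O}(J(L))$, $\eta(a)=\{j\in J(L)\mid j\le a\}$, is a lattice isomorphism with inverse $A\mapsto\bigvee A$. Two pairs consisting of a lattice and a real-valued function on it are isomorphic if there is a lattice isomorphism between the lattices carrying one function to the other; here the isomorphism is $\eta$, i.e. $\hat\delta(\eta(a))=\delta(a)$ for all $a\in L$. *)

theory Defs
  imports Complex_Main
begin

unbundle lattice_syntax

definition atoms :: "'a::order_bot set" where
  "atoms = {a. \<bottom> < a \<and> \<not> (\<exists>c. \<bottom> < c \<and> c < a)}"

definition lattice_diversity :: "('a::bounded_lattice_bot \<Rightarrow> real) \<Rightarrow> bool" where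
  "lattice_diversity \<delta> \<longleftrightarrow>
     (\<forall>a. 0 \<le> \<delta> a) \<and>
     (\<forall>a. \<delta> a = 0 \<longleftrightarrow> a \<in> atoms \<or> a = \<bottom>) \<and>
     (\<forall>a b. a \<le> b \<longrightarrow> \<delta> a \<le> \<delta> b) \<and>
     (\<forall>a b. a \<sqinter> b \<noteq> \<bottom> \<longrightarrow> \<delta> (a \<squnion> b) \<le> \<delta> a + \<delta> b)"

text \<open>A classical diversity on the set \<open>X\<close>; only the values of \<open>\<delta>\<close> on finite subsets of \<open>X\<close>
  are constrained.\<close>

definition diversity_on :: "'b set \<Rightarrow> ('b set \<Rightarrow> real) \<Rightarrow> bool" where
  "diversity_on X \<delta> \<longleftrightarrow>
     (\<forall>A. finite A \<and> A \<subseteq> X \<longrightarrow> 0 \<le> \<delta> A) \<and>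
     (\<forall>A. finite A \<and> A \<subseteq> X \<longrightarrow> (\<delta> A = 0 \<longleftrightarrow> card A \<le> 1)) \<and>
     (\<forall>A B C. finite A \<and> A \<subseteq> X \<and> finite B \<and> B \<subseteq> X \<and> finite C \<and> C \<subseteq> X \<and> B \<noteq> {}
        \<longrightarrow> \<delta> (A \<union> C) \<le> \<delta> (A \<union> B) + \<delta> (B \<union> C))"

definition join_irreducibles :: "'a::bounded_lattice_bot set" where
  "join_irreducibles = {a. a \<noteq> \<bottom> \<and> (\<forall>b c. a = b \<squnion> c \<longrightarrow> a = b \<or> a = c)}"

text \<open>Lower sets of the poset \<open>P\<close>, with the order induced from the ambient type.\<close>

definition lower_sets :: "'b::order set \<Rightarrow> 'b set set" where
  "lower_sets P = {X. X \<subseteq> P \<and> (\<forall>x\<in>X. \<forall>y\<in>P. y \<le> x \<longrightarrow> y \<in> X)}"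

definition sublattice :: "'b::lattice set \<Rightarrow> bool" where
  "sublattice M \<longleftrightarrow> (\<forall>x\<in>M. \<forall>y\<in>M. x \<sqinter> y \<in> M \<and> x \<squnion> y \<in> M)"

text \<open>\<open>lattice_function_iso h M f N g\<close>: \<open>h\<close> is a lattice isomorphism from \<open>M\<close> onto \<open>N\<close> carrying
  \<open>f\<close> (restricted to \<open>M\<close>) to \<open>g\<close> (restricted to \<open>N\<close>). The lattices \<open>M\<close> and \<open>N\<close> are given as
  sublattices of their ambient types; for a type of sets, \<open>\<sqinter>\<close> and \<open>\<squnion>\<close> are \<open>\<inter>\<close> and \<open>\<union>\<close>.\<close>

definition lattice_function_iso ::
    "('b::lattice \<Rightarrow> 'c::lattice) \<Rightarrow> 'b set \<Rightarrow> ('b \<Rightarrow> real) \<Rightarrow> 'c set \<Rightarrow> ('c \<Rightarrow> real) \<Rightarrow> bool" where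
  "lattice_function_iso h M f N g \<longleftrightarrow>
     sublattice M \<and> sublattice N \<and> bij_betw h M N \<and>
     (\<forall>x\<in>M. \<forall>y\<in>M. h (x \<sqinter> y) = h x \<sqinter> h y \<and> h (x \<squnion> y) = h x \<squnion> h y) \<and>
     (\<forall>x\<in>M. g (h x) = f x)"

definition birkhoff_eta :: "'a::bounded_lattice_bot \<Rightarrow> 'a set" where
  "birkhoff_eta a = {j \<in> join_irreducibles. j \<le> a}"

definition delta_hat :: "('a::finite_lattice \<Rightarrow> real) \<Rightarrow> 'a set \<Rightarrow> real" where
  "delta_hat \<delta> A = (if card A \<ge> 2 then \<delta> (\<Squnion>A) else 0)"

end

theory Submission
  imports Defs
begin

text \<open>In a finite lattice every element is the join of the join irreducibles below it, so an
  element with at most one join irreducible below it is \<open>\<bottom>\<close> or an atom. Conversely only one join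
  irreducible lies below an atom, and none below \<open>\<bottom>\<close>. Since a lattice diversity \<open>\<delta>\<close> vanishes
  exactly at \<open>\<bottom>\<close> and the atoms, \<open>\<delta> a = 0\<close> holds exactly if \<open>birkhoff_eta a\<close> has at most one
  element. This is why setting \<open>delta_hat \<delta>\<close> to \<open>0\<close> on sets with at most one element agrees with
  \<open>\<delta>\<close> on lower sets (\<open>delta_hat_birkhoff_eta\<close>) and creates no further zeros
  (\<open>delta_hat_eq_0_iff\<close>).

  For the triangle inequality, let \<open>b\<close> be a member of \<open>B\<close>. The joins of \<open>A \<union> B\<close> and of \<open>B \<union> C\<close>
  both lie above \<open>b \<noteq> \<bottom>\<close>, so the subadditivity of \<open>\<delta>\<close> on pairs with nonzero meet bounds \<open>\<delta>\<close> at
  their join, which lies above the join of \<open>A \<union> C\<close>. The only remaining case is that \<open>A \<union> B\<close> or \<open>B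
  \<union> C\<close> is a singleton; then it is \<open>B\<close>, so \<open>A \<union> C\<close> is contained in the other one and monotonicity
  suffices.

  Distributivity enters only through the isomorphism: it makes join irreducibles join prime
  (\<open>join_irreducible_le_Sup_iff\<close>), which is what makes \<open>birkhoff_eta\<close> preserve joins and reach
  every lower set.\<close>

section \<open>Join irreducibles in a finite lattice\<close>

lemma join_irreducible_neq_bot: "j \<in> join_irreducibles \<Longrightarrow> j \<noteq> \<bottom>"
  by (simp add: join_irreducibles_def)

lemma birkhoff_eta_mono: "a \<le> b \<Longrightarrow> birkhoff_eta a \<subseteq> birkhoff_eta b"
  by (auto simp: birkhoff_eta_def)

text \<open>An element that is neither \<open>\<bottom>\<close> nor join irreducible is a join of two strictly smaller
  elements, so the decomposition follows by induction along \<open><\<close>.\<close>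

lemma Sup_birkhoff_eta:
  fixes a :: "'a::finite_lattice"
  shows "\<Squnion>(birkhoff_eta a) = a"
proof (induction "card {x. x < a}" arbitrary: a rule: less_induct)
  case less
  show ?case
  proof (rule antisym)
    show "\<Squnion>(birkhoff_eta a) \<le> a"
      by (rule Sup_least) (simp add: birkhoff_eta_def)
    show "a \<le> \<Squnion>(birkhoff_eta a)"
    proof (cases "a = \<bottom> \<or> a \<in> join_irreducibles")
      case True
      then show ?thesis
        by (auto simp: birkhoff_eta_def intro: Sup_upper)
    next
      case False
      then obtain b c where bc: "a = b \<squnion> c" "a \<noteq> b" "a \<noteq> c"
        by (auto simp: join_irreducibles_def)
      have below: "x \<le> \<Squnion>(birkhoff_eta a)" if "x < a" for x
      proof -
        have "{y. y < x} \<subset> {y. y < a}"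
          using that by auto
        then have "\<Squnion>(birkhoff_eta x) = x"
          by (intro less) (simp add: psubset_card_mono)
        moreover have "birkhoff_eta x \<subseteq> birkhoff_eta a"
          using that by (simp add: birkhoff_eta_mono)
        ultimately show ?thesis
          using Sup_subset_mono by metis
      qed
      have "b < a" "c < a"
        using bc by (simp_all add: less_le)
      then have "b \<squnion> c \<le> \<Squnion>(birkhoff_eta a)"
        by (simp add: below)
      then show ?thesis
        by (simp add: bc(1))
    qed
  qed
qed

lemma card_le_1_subset_singleton:
  assumes "finite A" "card A \<le> 1"
  obtains x where "A \<subseteq> {x}"
  using assms by (metis One_nat_def card_le_Suc0_iff_eq insertCI subsetI)

lemma card_birkhoff_eta_le_1_iff:
  fixes a :: "'a::finite_lattice"
  shows "card (birkhoff_eta a) \<le> 1 \<longleftrightarrow> a \<in> atoms \<or> a = \<bottom>"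
proof
  assume "card (birkhoff_eta a) \<le> 1"
  then obtain j where j: "birkhoff_eta a \<subseteq> {j}"
    by (rule card_le_1_subset_singleton[OF finite])
  \<comment> \<open>Every element is recovered from its join irreducibles, and those below some \<open>c \<le> a\<close>
    can only be \<open>{}\<close> or \<open>{j}\<close>.\<close>
  have two: "c = \<bottom> \<or> c = j" if "c \<le> a" for c
  proof -
    have "birkhoff_eta c \<subseteq> {j}"
      using birkhoff_eta_mono[OF that] j by (rule subset_trans)
    then have "birkhoff_eta c = {} \<or> birkhoff_eta c = {j}"
      by blast
    then show ?thesis
      by (metis Sup_birkhoff_eta Sup_empty Sup_insert sup_bot_right)
  qed
  show "a \<in> atoms \<or> a = \<bottom>"
  proof (cases "a = \<bottom>")
    case False
    then have "a = j"
      using two[of a] by simp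
    then have "c = \<bottom>" if "c < a" for c
      using two[OF less_imp_le[OF that]] that by auto
    then show ?thesis
      using False by (auto simp: atoms_def bot_less)
  qed simp
next
  assume "a \<in> atoms \<or> a = \<bottom>"
  then have "birkhoff_eta a \<subseteq> {a}"
    by (auto simp: birkhoff_eta_def atoms_def join_irreducibles_def bot_less less_le bot_unique)
  then show "card (birkhoff_eta a) \<le> 1"
    using card_mono[of "{a}" "birkhoff_eta a"] by simp
qed

section \<open>The classical diversity on the join irreducibles\<close>

lemma subset_birkhoff_eta_Sup:
  fixes A :: "'a::finite_lattice set"
  shows "A \<subseteq> join_irreducibles \<Longrightarrow> A \<subseteq> birkhoff_eta (\<Squnion>A)"
  by (auto simp: birkhoff_eta_def intro: Sup_upper)

lemma delta_hat_nonneg: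
  "lattice_diversity \<delta> \<Longrightarrow> 0 \<le> delta_hat \<delta> A"
  by (simp add: delta_hat_def lattice_diversity_def)

lemma delta_hat_mono:
  assumes "lattice_diversity \<delta>" "A \<subseteq> B"
  shows "delta_hat \<delta> A \<le> delta_hat \<delta> B"
proof -
  have "card A \<le> card B"
    using assms(2) by (simp add: card_mono)
  moreover have "\<delta> (\<Squnion>A) \<le> \<delta> (\<Squnion>B)"
    using assms by (simp add: lattice_diversity_def Sup_subset_mono)
  moreover have "0 \<le> \<delta> (\<Squnion>B)"
    using assms(1) by (simp add: lattice_diversity_def)
  ultimately show ?thesis
    by (simp add: delta_hat_def)
qed

text \<open>A set of join irreducibles is contained in the lower set of its join, so a set with two
  elements cannot have \<open>\<bottom>\<close> or an atom as its join.\<close>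

lemma delta_hat_eq_0_iff:
  assumes \<delta>: "lattice_diversity \<delta>" and A: "A \<subseteq> join_irreducibles"
  shows "delta_hat \<delta> A = 0 \<longleftrightarrow> card A \<le> 1"
proof -
  have "\<delta> (\<Squnion>A) = 0 \<longleftrightarrow> card (birkhoff_eta (\<Squnion>A)) \<le> 1"
    using \<delta> by (simp only: card_birkhoff_eta_le_1_iff lattice_diversity_def)
  moreover have "card A \<le> card (birkhoff_eta (\<Squnion>A))"
    using subset_birkhoff_eta_Sup[OF A] by (simp add: card_mono)
  ultimately show ?thesis
    by (auto simp: delta_hat_def)
qed

lemma delta_hat_triangle:
  assumes \<delta>: "lattice_diversity \<delta>" and B: "B \<subseteq> join_irreducibles" "B \<noteq> {}"
  shows "delta_hat \<delta> (A \<union> C) \<le> delta_hat \<delta> (A \<union> B) + delta_hat \<delta> (B \<union> C)"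
proof -
  obtain b where b: "b \<in> B"
    using B(2) by blast
  consider "card (A \<union> B) \<le> 1" | "card (B \<union> C) \<le> 1" | "card (A \<union> B) \<ge> 2" "card (B \<union> C) \<ge> 2"
    by linarith
  then show ?thesis
  proof cases
    case 1
    then obtain x where "A \<union> B \<subseteq> {x}"
      by (rule card_le_1_subset_singleton[OF finite])
    then have "A \<union> C \<subseteq> B \<union> C"
      using b by auto
    then show ?thesis
      using delta_hat_mono[OF \<delta>] delta_hat_nonneg[OF \<delta>, of "A \<union> B"]
      by (simp add: add_increasing)
  next
    case 2
    then obtain x where "B \<union> C \<subseteq> {x}"
      by (rule card_le_1_subset_singleton[OF finite])
    then have "A \<union> C \<subseteq> A \<union> B"
      using b by auto
    then show ?thesis
      using delta_hat_mono[OF \<delta>] delta_hat_nonneg[OF \<delta>, of "B \<union> C"]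
      by (simp add: add_increasing2)
  next
    case 3
    have "b \<le> \<Squnion>(A \<union> B) \<sqinter> \<Squnion>(B \<union> C)"
      using b by (auto intro: Sup_upper)
    then have meet: "\<Squnion>(A \<union> B) \<sqinter> \<Squnion>(B \<union> C) \<noteq> \<bottom>"
      using b B(1) join_irreducible_neq_bot by (metis bot.extremum_uniqueI subsetD)
    have "\<Squnion>(A \<union> C) \<le> \<Squnion>(A \<union> B) \<squnion> \<Squnion>(B \<union> C)"
      by (metis Sup_subset_mono Sup_union_distrib Un_mono Un_upper1 Un_upper2)
    then have "\<delta> (\<Squnion>(A \<union> C)) \<le> \<delta> (\<Squnion>(A \<union> B)) + \<delta> (\<Squnion>(B \<union> C))"
      using \<delta> meet unfolding lattice_diversity_def by (meson order_trans)
    moreover have "delta_hat \<delta> (A \<union> C) \<le> \<delta> (\<Squnion>(A \<union> C))"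
      using \<delta> by (simp add: delta_hat_def lattice_diversity_def)
    ultimately show ?thesis
      using 3 by (simp add: delta_hat_def)
  qed
qed

lemma diversity_on_join_irreducibles:
  assumes "lattice_diversity \<delta>"
  shows "diversity_on join_irreducibles (delta_hat \<delta>)"
  using assms
  by (simp add: diversity_on_def delta_hat_nonneg delta_hat_eq_0_iff delta_hat_triangle)

section \<open>The isomorphism with the lower sets\<close>

text \<open>Distributivity gives \<open>j = (j \<sqinter> a) \<squnion> (j \<sqinter> b)\<close> whenever \<open>j \<le> a \<squnion> b\<close>, and irreducibility
  selects one of the two parts.\<close>

lemma join_irreducible_le_sup_iff:
  fixes j :: "'a::finite_distrib_lattice"
  assumes "j \<in> join_irreducibles"
  shows "j \<le> a \<squnion> b \<longleftrightarrow> j \<le> a \<or> j \<le> b"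
proof
  assume "j \<le> a \<squnion> b"
  then have "j = (j \<sqinter> a) \<squnion> (j \<sqinter> b)"
    by (simp add: inf_sup_distrib1[symmetric] inf_absorb1)
  then have "j = j \<sqinter> a \<or> j = j \<sqinter> b"
    using assms unfolding join_irreducibles_def by blast
  then show "j \<le> a \<or> j \<le> b"
    by (metis inf_le2)
qed (auto intro: le_supI1 le_supI2)

lemma join_irreducible_le_Sup_iff:
  fixes j :: "'a::finite_distrib_lattice"
  assumes "j \<in> join_irreducibles"
  shows "j \<le> \<Squnion>A \<longleftrightarrow> (\<exists>x\<in>A. j \<le> x)"
  using finite[of A]
proof induction
  case empty
  show ?case
    using join_irreducible_neq_bot[OF assms] by (simp add: bot_unique)
next
  case (insert x A)
  then show ?case
    by (simp add: join_irreducible_le_sup_iff[OF assms])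
qed

lemma birkhoff_eta_in_lower_sets: "birkhoff_eta a \<in> lower_sets join_irreducibles"
  by (auto simp: birkhoff_eta_def lower_sets_def)

lemma birkhoff_eta_Sup:
  fixes A :: "'a::finite_distrib_lattice set"
  assumes "A \<in> lower_sets join_irreducibles"
  shows "birkhoff_eta (\<Squnion>A) = A"
  using assms
  by (auto simp: birkhoff_eta_def lower_sets_def join_irreducible_le_Sup_iff intro: Sup_upper)

lemma bij_betw_birkhoff_eta:
  "bij_betw birkhoff_eta (UNIV :: 'a::finite_distrib_lattice set) (lower_sets join_irreducibles)"
  by (rule bij_betw_byWitness[where f' = Sup])
    (auto simp: Sup_birkhoff_eta birkhoff_eta_Sup birkhoff_eta_in_lower_sets)

lemma birkhoff_eta_inf: "birkhoff_eta (a \<sqinter> b) = birkhoff_eta a \<inter> birkhoff_eta b"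
  by (auto simp: birkhoff_eta_def)

lemma birkhoff_eta_sup:
  fixes a b :: "'a::finite_distrib_lattice"
  shows "birkhoff_eta (a \<squnion> b) = birkhoff_eta a \<union> birkhoff_eta b"
  by (auto simp: birkhoff_eta_def join_irreducible_le_sup_iff)

lemma sublattice_lower_sets: "sublattice (lower_sets P)"
  by (auto simp: sublattice_def lower_sets_def)

lemma delta_hat_birkhoff_eta:
  assumes "lattice_diversity \<delta>"
  shows "delta_hat \<delta> (birkhoff_eta a) = \<delta> a"
proof (cases "card (birkhoff_eta a) \<le> 1")
  case True
  then have "\<delta> a = 0"
    using assms by (simp only: card_birkhoff_eta_le_1_iff lattice_diversity_def)
  then show ?thesis
    using True by (simp add: delta_hat_def)
next
  case False
  then show ?thesis
    by (simp add: delta_hat_def Sup_birkhoff_eta)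
qed

lemma lattice_function_iso_birkhoff_eta:
  fixes \<delta> :: "'a::finite_distrib_lattice \<Rightarrow> real"
  assumes "lattice_diversity \<delta>"
  shows "lattice_function_iso birkhoff_eta UNIV \<delta> (lower_sets join_irreducibles) (delta_hat \<delta>)"
  unfolding lattice_function_iso_def
  using bij_betw_birkhoff_eta sublattice_lower_sets delta_hat_birkhoff_eta[OF assms]
  by (auto simp: birkhoff_eta_inf birkhoff_eta_sup sublattice_def[of UNIV])

theorem theorem9:
  fixes \<delta> :: "'a::finite_distrib_lattice \<Rightarrow> real"
  assumes "lattice_diversity \<delta>"
  shows "diversity_on (join_irreducibles :: 'a set) (delta_hat \<delta>) \<and>
    lattice_function_iso birkhoff_eta (UNIV :: 'a set) \<delta>
      (lower_sets (join_irreducibles :: 'a set)) (delta_hat \<delta>)"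
  using assms diversity_on_join_irreducibles lattice_function_iso_birkhoff_eta by blast

end
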